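(* Let $(L,[-,-,-])$ be a ternary Leibniz algebra over a field $\mathbb{K}$ and let $N:L\to L$ be a linear operator. \begin{enumerate} \item[1)] If $N^2=0$, then $N$ is a Nijenhuis operator on $L$ if and only if $N$ is a Rota-Baxter operator of weight $0$ on $L$. \item[2)] If $N^2=N$, then $N$ is a Nijenhuis operator on $L$ if $N$ is a Rota-Baxter operator of weight $-1$ on $L$. \end{enumerate}
   Context: A ternary Leibniz algebra is a vector space $L$ with a trilinear bracket satisfying $[[x,y,z],t,u]=[x,y,[z,t,u]]+[x,[y,t,u],z]+[[x,t,u],y,z]$ for all $x,y,z,t,u\in L$. A Rota-Baxter operator of weight $\lambda\in\mathbb{K}$ on it is a linear map $R$ with, for all $x,y,z\in L$, \begin{align*} [R(x),R(y),R(z)]=R\big(&[R(x),R(y),z]+[R(x),y,R(z)]+[x,R(y),R(z)]\\ &+\lambda[R(x),y,z]+\lambda[x,R(y),z]+\lambda[x,y,R(z)]+\lambda^2[x,y,z]\big). \end{align*} A Nijenhuis operator on it is a linear map $N$ with, for all $x,y,z\in L$, \begin{align*} [N(x),N(y),N(z)]&=N\big([N(x),N(y),z]+[N(x),y,N(z)]+[x,N(y),N(z)]\big)\\ &\quad-N^2\big([N(x),y,z]+[x,N(y),z]+[x,y,N(z)]\big)+N^3([x,y,z]). \end{align*} *)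

theory Defs
  imports Complex_Main
begin

locale ternary_leibniz_algebra = vector_space scale
  for scale :: "'k::field \<Rightarrow> 'v::ab_group_add \<Rightarrow> 'v" +
  fixes br :: "'v \<Rightarrow> 'v \<Rightarrow> 'v \<Rightarrow> 'v"
  assumes linear_fst: "Vector_Spaces.linear scale scale (\<lambda>x. br x y z)"
    and linear_snd: "Vector_Spaces.linear scale scale (\<lambda>y. br x y z)"
    and linear_trd: "Vector_Spaces.linear scale scale (\<lambda>z. br x y z)"
    and leibniz: "br (br x y z) t u = br x y (br z t u) + br x (br y t u) z + br (br x t u) y z"

definition rota_baxter_operator ::
  "('k::field \<Rightarrow> 'v::ab_group_add \<Rightarrow> 'v) \<Rightarrow> ('v \<Rightarrow> 'v \<Rightarrow> 'v \<Rightarrow> 'v) \<Rightarrow> 'k \<Rightarrow> ('v \<Rightarrow> 'v) \<Rightarrow> bool"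
  where "rota_baxter_operator scale br w R \<longleftrightarrow>
    Vector_Spaces.linear scale scale R \<and>
    (\<forall>x y z. br (R x) (R y) (R z) =
      R (br (R x) (R y) z + br (R x) y (R z) + br x (R y) (R z)
         + scale w (br (R x) y z) + scale w (br x (R y) z) + scale w (br x y (R z))
         + scale (w^2) (br x y z)))"

definition nijenhuis_operator ::
  "('k::field \<Rightarrow> 'v::ab_group_add \<Rightarrow> 'v) \<Rightarrow> ('v \<Rightarrow> 'v \<Rightarrow> 'v \<Rightarrow> 'v) \<Rightarrow> ('v \<Rightarrow> 'v) \<Rightarrow> bool"
  where "nijenhuis_operator scale br N \<longleftrightarrow>
    Vector_Spaces.linear scale scale N \<and>
    (\<forall>x y z. br (N x) (N y) (N z) =
      N (br (N x) (N y) z + br (N x) y (N z) + br x (N y) (N z))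
      - (N ^^ 2) (br (N x) y z + br x (N y) z + br x y (N z))
      + (N ^^ 3) (br x y z))"

end

theory Submission imports Defs
begin

text \<open>
  Both operator identities express \<open>br (N x) (N y) (N z)\<close> through the same three expressions: the
  sum \<open>A\<close> of the brackets in which two entries carry \<open>N\<close>, the sum \<open>B\<close> of those in which one entry
  does, and \<open>C = br x y z\<close>. The Nijenhuis identity has right-hand side \<open>N A - N\<^sup>2 B + N\<^sup>3 C\<close>, and the
  Rota-Baxter identity of weight \<open>w\<close> has \<open>N (A + w B + w\<^sup>2 C)\<close>.

  If \<open>N\<^sup>2 = 0\<close>, then \<open>N\<^sup>3 = 0\<close> as well, and the first expression becomes \<open>N A\<close>, which is the second
  one at \<open>w = 0\<close>. If \<open>N\<^sup>2 = N\<close>, then \<open>N\<^sup>3 = N\<close> as well, and by additivity the first expression becomes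
  \<open>N (A - B + C)\<close>, which is the second one at \<open>w = -1\<close>. In both
  cases the two notions coincide.
\<close>

lemma nijenhuis_iff_rota_baxter_of_square_zero:
  fixes br :: "'v::ab_group_add \<Rightarrow> 'v \<Rightarrow> 'v \<Rightarrow> 'v"
  assumes lin: "Vector_Spaces.linear scale scale N" and sq: "N ^^ 2 = (\<lambda>x. 0)"
  shows "nijenhuis_operator scale br N \<longleftrightarrow> rota_baxter_operator scale br 0 N"
proof -
  interpret Vector_Spaces.linear scale scale N by (rule lin)
  have cube: "N ^^ 3 = (\<lambda>x. 0)"
    using sq zero by (simp add: numeral_3_eq_3 numeral_2_eq_2 fun_eq_iff)
  show ?thesis
    using lin by (simp add: nijenhuis_operator_def rota_baxter_operator_def sq cube)
qed

lemma nijenhuis_iff_rota_baxter_of_idempotent: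
  fixes br :: "'v::ab_group_add \<Rightarrow> 'v \<Rightarrow> 'v \<Rightarrow> 'v"
  assumes lin: "Vector_Spaces.linear scale scale N" and sq: "N ^^ 2 = N"
  shows "nijenhuis_operator scale br N \<longleftrightarrow> rota_baxter_operator scale br (- 1) N"
proof -
  interpret Vector_Spaces.linear scale scale N by (rule lin)
  have cube: "N ^^ 3 = N"
    using sq by (simp add: numeral_3_eq_3 numeral_2_eq_2 fun_eq_iff)
  show ?thesis
    using lin by (simp add: nijenhuis_operator_def rota_baxter_operator_def sq cube
        add diff neg algebra_simps)
qed

theorem proposition2p13:
  fixes scale :: "'k::field \<Rightarrow> 'v::ab_group_add \<Rightarrow> 'v"
    and br :: "'v \<Rightarrow> 'v \<Rightarrow> 'v \<Rightarrow> 'v"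
    and N :: "'v \<Rightarrow> 'v"
  assumes "ternary_leibniz_algebra scale br"
    and "Vector_Spaces.linear scale scale N"
  shows "(N ^^ 2 = (\<lambda>x. 0) \<longrightarrow>
            (nijenhuis_operator scale br N \<longleftrightarrow> rota_baxter_operator scale br 0 N))
       \<and> (N ^^ 2 = N \<longrightarrow>
            (rota_baxter_operator scale br (- 1) N \<longrightarrow> nijenhuis_operator scale br N))"
  using nijenhuis_iff_rota_baxter_of_square_zero[OF assms(2)]
    nijenhuis_iff_rota_baxter_of_idempotent[OF assms(2)] by blast

end
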